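(* Let $G$ be a finite group. For each $x\in G$ let $[x]$ denote the set of all generators of the cyclic subgroup $\langle x\rangle$, and fix, for each distinct such set, an arbitrary linear ordering of its elements. For $x,y\in G$ write $x\prec y$ if either ($x,y$ lie in the same set $[x]=[y]$ and $x$ precedes $y$ in the fixed ordering of this set) or $\langle x\rangle\subsetneqq\langle y\rangle$. Let $\mathcal O_G$ be the digraph with vertex set $G$ having an arc from $x$ to $y$ if and only if $y\prec x$. Then $\mathcal O_G$ is a transitive orientation of the power graph $\mathcal P_G$ and is a subdigraph of the power digraph $\overrightarrow{\mathcal P}_G$. Moreover, if $\mathcal O'$ is any transitive orientation of $\mathcal P_G$ that is a subdigraph of $\overrightarrow{\mathcal P}_G$, then $\mathcal O'$ and $\mathcal O_G$ are isomorphic digraphs.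
   Context: All groups are finite. The power graph $\mathcal P_G$ has vertex set $G$, two distinct elements being adjacent iff one is a power of the other. The power digraph $\overrightarrow{\mathcal P}_G$ has vertex set $G$ and an arc from $x$ to $y$ iff $x\neq y$ and $y=x^m$ for some positive integer $m$. An orientation of a graph $\Gamma$ is a digraph $\mathcal O$ on $V(\Gamma)$ such that for each edge $\{u,v\}$ of $\Gamma$ exactly one of $(u,v),(v,u)$ is an arc of $\mathcal O$, and $\mathcal O$ has no other arcs; it is transitive if arcs $(u,v),(v,w)$ imply the arc $(u,w)$. *)

theory Defs
  imports "HOL-Algebra.Generated_Groups" "Graph_Theory.Graph_Theory"
begin

text \<open>
  Digraphs without multiple arcs are \<^typ>\<open>'a pair_pre_digraph\<close>; as in the AFP entry on graph theory, an
  undirected graph is a symmetric digraph, so that an edge \<open>{u, v}\<close> is the pair of arcs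
  \<open>(u, v)\<close> and \<open>(v, u)\<close>.
\<close>

definition is_pos_power :: "('a, 'b) monoid_scheme \<Rightarrow> 'a \<Rightarrow> 'a \<Rightarrow> bool" where
  "is_pos_power G y x \<longleftrightarrow> (\<exists>m::nat. 0 < m \<and> y = x [^]\<^bsub>G\<^esub> m)"

definition power_graph :: "('a, 'b) monoid_scheme \<Rightarrow> 'a pair_pre_digraph" where
  "power_graph G =
     \<lparr> pverts = carrier G,
       parcs = {(x, y). x \<in> carrier G \<and> y \<in> carrier G \<and> x \<noteq> y \<and>
                        (is_pos_power G x y \<or> is_pos_power G y x)} \<rparr>"

definition power_digraph :: "('a, 'b) monoid_scheme \<Rightarrow> 'a pair_pre_digraph" where
  "power_digraph G =
     \<lparr> pverts = carrier G,
       parcs = {(x, y). x \<in> carrier G \<and> y \<in> carrier G \<and> x \<noteq> y \<and> is_pos_power G y x} \<rparr>"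

definition orientation :: "'a pair_pre_digraph \<Rightarrow> 'a pair_pre_digraph \<Rightarrow> bool" where
  "orientation \<Gamma> D \<longleftrightarrow>
     pverts D = pverts \<Gamma> \<and>
     (\<forall>(u, v) \<in> parcs \<Gamma>. ((u, v) \<in> parcs D) \<noteq> ((v, u) \<in> parcs D)) \<and>
     parcs D \<subseteq> parcs \<Gamma>"

definition transitive_orientation :: "'a pair_pre_digraph \<Rightarrow> 'a pair_pre_digraph \<Rightarrow> bool" where
  "transitive_orientation \<Gamma> D \<longleftrightarrow> orientation \<Gamma> D \<and> trans (parcs D)"

definition gen_class :: "('a, 'b) monoid_scheme \<Rightarrow> 'a \<Rightarrow> 'a set" where
  "gen_class G x = {y \<in> generate G {x}. generate G {y} = generate G {x}}"

text \<open>
  \<open>L\<close> assigns to each class \<open>gen_class G x\<close> its (reflexive) linear order; \<open>x\<close> precedes \<open>y\<close> in it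
  if \<open>(x, y)\<close> belongs to its strict part.
\<close>

definition prec :: "('a, 'b) monoid_scheme \<Rightarrow> ('a set \<Rightarrow> 'a rel) \<Rightarrow> 'a \<Rightarrow> 'a \<Rightarrow> bool" where
  "prec G L x y \<longleftrightarrow>
     gen_class G x = gen_class G y \<and> (x, y) \<in> L (gen_class G x) \<and> x \<noteq> y \<or>
     generate G {x} \<subset> generate G {y}"

definition order_digraph ::
    "('a, 'b) monoid_scheme \<Rightarrow> ('a set \<Rightarrow> 'a rel) \<Rightarrow> 'a pair_pre_digraph" where
  "order_digraph G L =
     \<lparr> pverts = carrier G,
       parcs = {(x, y). x \<in> carrier G \<and> y \<in> carrier G \<and> prec G L y x} \<rparr>"

end

theory Submission
  imports Defs "HOL-Algebra.Multiplicative_Group"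
begin

text \<open>
  For elements of finite order, \<open>y\<close> is a positive power of \<open>x\<close> iff \<open>\<langle>y\<rangle> \<subseteq> \<langle>x\<rangle>\<close>, so the power graph
  and the power digraph only depend on the map \<open>x \<mapsto> \<langle>x\<rangle>\<close> into the poset of subgroups. For any map
  \<open>q\<close> into a poset, a transitive orientation of the comparability graph of \<open>q\<close> that never ascends
  has no choice between different fibres of \<open>q\<close>, and inside each fibre it is an arbitrary strict
  linear order. As two strict linear orders of a finite set are isomorphic, permuting each
  fibre separately turns any such orientation into any other.
\<close>

section \<open>Finite strict linear orders\<close>

lemma finite_strict_linear_order_rank:
  assumes "finite A" and "strict_linear_order_on A r"
  obtains f where "bij_betw f A {..<card A}"
    and "\<And>x y. x \<in> A \<Longrightarrow> y \<in> A \<Longrightarrow> (x, y) \<in> r \<longleftrightarrow> f x < f y"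
proof -
  have r: "trans r" "irrefl r" "total_on A r"
    using assms by (auto simp: strict_linear_order_on_def)
  define pred where "pred x = {z \<in> A. (z, x) \<in> r}" for x
  have finite_pred: "finite (pred x)" for x
    using \<open>finite A\<close> by (simp add: pred_def)
  have not_self: "x \<notin> pred x" for x
    using r(2) by (simp add: pred_def irrefl_def)
  have mono: "card (pred x) < card (pred y)" if "x \<in> A" "(x, y) \<in> r" for x y
  proof -
    have "pred x \<subseteq> pred y"
      using that(2) r(1) by (auto simp: pred_def dest: transD)
    moreover have "x \<in> pred y"
      using that by (simp add: pred_def)
    ultimately show ?thesis
      using finite_pred not_self by (metis psubsetI psubset_card_mono)
  qed
  have iff: "(x, y) \<in> r \<longleftrightarrow> card (pred x) < card (pred y)" if "x \<in> A" "y \<in> A" for x y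
    using that mono r(3) by (metis order_less_asym less_irrefl total_on_def)
  have "inj_on (\<lambda>x. card (pred x)) A"
    using iff r(3) by (fastforce simp: inj_on_def total_on_def)
  moreover have "pred x \<subset> A" if "x \<in> A" for x
    using that not_self[of x] by (auto simp: pred_def)
  then have "(\<lambda>x. card (pred x)) ` A \<subseteq> {..<card A}"
    using \<open>finite A\<close> by (auto intro: psubset_card_mono)
  ultimately have "bij_betw (\<lambda>x. card (pred x)) A {..<card A}"
    by (simp add: bij_betw_def card_image card_subset_eq)
  then show thesis
    using iff by (rule that)
qed

lemma finite_strict_linear_order_iso:
  assumes "finite A" and "finite B" and "card A = card B"
    and "strict_linear_order_on A r" and "strict_linear_order_on B s"
  obtains f where "bij_betw f A B"
    and "\<And>x y. x \<in> A \<Longrightarrow> y \<in> A \<Longrightarrow> (x, y) \<in> r \<longleftrightarrow> (f x, f y) \<in> s"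
proof -
  obtain g where g: "bij_betw g A {..<card A}"
    and g_less: "\<And>x y. x \<in> A \<Longrightarrow> y \<in> A \<Longrightarrow> (x, y) \<in> r \<longleftrightarrow> g x < g y"
    using finite_strict_linear_order_rank[OF assms(1,4)] by blast
  obtain h where h: "bij_betw h B {..<card B}"
    and h_less: "\<And>x y. x \<in> B \<Longrightarrow> y \<in> B \<Longrightarrow> (x, y) \<in> s \<longleftrightarrow> h x < h y"
    using finite_strict_linear_order_rank[OF assms(2,5)] by blast
  let ?f = "inv_into B h \<circ> g"
  have f: "bij_betw ?f A B"
    using g bij_betw_inv_into[OF h] \<open>card A = card B\<close> by (auto intro: bij_betw_trans)
  have "h (?f x) = g x" if "x \<in> A" for x
    using that bij_betwE[OF g] bij_betw_inv_into_right[OF h] \<open>card A = card B\<close> by simp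
  then have "(x, y) \<in> r \<longleftrightarrow> (?f x, ?f y) \<in> s" if "x \<in> A" "y \<in> A" for x y
    using that g_less h_less bij_betwE[OF f] by simp
  with f show thesis
    by (rule that)
qed

section \<open>Fibrewise linear relations\<close>

abbreviation fibre :: "'a set \<Rightarrow> ('a \<Rightarrow> 'c) \<Rightarrow> 'c \<Rightarrow> 'a set" where
  "fibre A q c \<equiv> {x \<in> A. q x = c}"

lemma bij_betw_fibrewise:
  assumes F: "\<And>c. bij_betw (F c) (fibre A p c) (fibre B q c)"
  shows "bij_betw (\<lambda>x. F (p x) x) A B"
proof (rule bij_betwI')
  have F_fibre: "F (p x) x \<in> B" "q (F (p x) x) = p x" if "x \<in> A" for x
    using bij_betwE[OF F] that by auto
  fix x assume "x \<in> A"
  then show "F (p x) x \<in> B"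
    by (rule F_fibre)
  fix y assume "y \<in> A"
  show "F (p x) x = F (p y) y \<longleftrightarrow> x = y"
  proof
    assume eq: "F (p x) x = F (p y) y"
    then have "p x = p y"
      using F_fibre(2) \<open>x \<in> A\<close> \<open>y \<in> A\<close> by metis
    then show "x = y"
      using eq \<open>x \<in> A\<close> \<open>y \<in> A\<close> inj_onD[OF bij_betw_imp_inj_on[OF F[of "p x"]], of x y] by simp
  qed simp
next
  fix y assume "y \<in> B"
  then have "y \<in> F (q y) ` fibre A p (q y)"
    using bij_betw_imp_surj_on[OF F] by simp
  then obtain x where "x \<in> A" "p x = q y" "y = F (q y) x"
    by auto
  then show "\<exists>x\<in>A. y = F (p x) x"
    by (intro bexI[of _ x]) simp_all
qed

definition fibrewise_linear_on :: "'a set \<Rightarrow> ('a \<Rightarrow> 'c::order) \<Rightarrow> 'a rel \<Rightarrow> bool" where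
  "fibrewise_linear_on A q R \<longleftrightarrow>
     R \<subseteq> A \<times> A \<and>
     (\<forall>x\<in>A. \<forall>y\<in>A. q x \<noteq> q y \<longrightarrow> ((x, y) \<in> R \<longleftrightarrow> q y < q x)) \<and>
     (\<forall>c. strict_linear_order_on (fibre A q c) (Restr R (fibre A q c)))"

lemma fibrewise_linear_onD:
  assumes "fibrewise_linear_on A q R"
  shows "R \<subseteq> A \<times> A"
    and "\<And>x y. x \<in> A \<Longrightarrow> y \<in> A \<Longrightarrow> q x \<noteq> q y \<Longrightarrow> (x, y) \<in> R \<longleftrightarrow> q y < q x"
    and "\<And>c. strict_linear_order_on (fibre A q c) (Restr R (fibre A q c))"
  using assms by (simp_all add: fibrewise_linear_on_def)

lemma fibrewise_linear_on_imp_le: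
  assumes "fibrewise_linear_on A q R" and "(x, y) \<in> R"
  shows "q y \<le> q x"
proof -
  have "x \<in> A" "y \<in> A"
    using fibrewise_linear_onD(1)[OF assms(1)] assms(2) by auto
  then show ?thesis
    using fibrewise_linear_onD(2)[OF assms(1), of x y] assms(2) by (cases "q x = q y") auto
qed

lemma fibrewise_linear_on_irrefl:
  assumes "fibrewise_linear_on A q R"
  shows "irrefl R"
proof (rule irreflI)
  fix x
  have "irrefl (Restr R (fibre A q (q x)))"
    using fibrewise_linear_onD(3)[OF assms] by (simp add: strict_linear_order_on_def)
  then show "(x, x) \<notin> R"
    using fibrewise_linear_onD(1)[OF assms] by (auto simp: irrefl_def)
qed

lemma fibrewise_linear_on_trans:
  assumes "fibrewise_linear_on A q R"
  shows "trans R"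
proof (rule transI)
  fix x y z assume xy: "(x, y) \<in> R" and yz: "(y, z) \<in> R"
  then have A: "x \<in> A" "y \<in> A" "z \<in> A"
    using fibrewise_linear_onD(1)[OF assms] by auto
  have le: "q y \<le> q x" "q z \<le> q y"
    using fibrewise_linear_on_imp_le[OF assms] xy yz by auto
  show "(x, z) \<in> R"
  proof (cases "q x = q z")
    case True
    then have "q y = q x" "q z = q x"
      using le by auto
    moreover have "trans (Restr R (fibre A q (q x)))"
      using fibrewise_linear_onD(3)[OF assms] by (simp add: strict_linear_order_on_def)
    ultimately show ?thesis
      using transD[of "Restr R (fibre A q (q x))" x y z] A xy yz by simp
  next
    case False
    then have "q z < q x"
      using le by auto
    then show ?thesis
      using fibrewise_linear_onD(2)[OF assms A(1,3) False] by simp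
  qed
qed

lemma fibrewise_linear_on_comparable:
  assumes "fibrewise_linear_on A q R" and "x \<in> A" "y \<in> A" "x \<noteq> y" and "q x \<le> q y \<or> q y \<le> q x"
  shows "(x, y) \<in> R \<or> (y, x) \<in> R"
proof (cases "q x = q y")
  case True
  have "total_on (fibre A q (q x)) (Restr R (fibre A q (q x)))"
    using fibrewise_linear_onD(3)[OF assms(1)] by (simp add: strict_linear_order_on_def)
  then show ?thesis
    using assms(2-4) True by (auto simp: total_on_def)
next
  case False
  then show ?thesis
    using fibrewise_linear_onD(2)[OF assms(1)] assms(2,3,5) by (metis order_le_less)
qed

lemma fibrewise_linear_on_iso:
  assumes finite_fibre: "\<And>c. finite (fibre A q c)"
    and R: "fibrewise_linear_on A q R" and S: "fibrewise_linear_on A q S"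
  obtains f where "bij_betw f A A"
    and "\<And>x y. x \<in> A \<Longrightarrow> y \<in> A \<Longrightarrow> (x, y) \<in> R \<longleftrightarrow> (f x, f y) \<in> S"
proof -
  have "\<forall>c. \<exists>f. bij_betw f (fibre A q c) (fibre A q c) \<and>
      (\<forall>x\<in>fibre A q c. \<forall>y\<in>fibre A q c. (x, y) \<in> R \<longleftrightarrow> (f x, f y) \<in> S)"
    (is "\<forall>c. ?fibre_iso c")
  proof
    fix c
    obtain f where f: "bij_betw f (fibre A q c) (fibre A q c)"
      and "\<And>x y. x \<in> fibre A q c \<Longrightarrow> y \<in> fibre A q c \<Longrightarrow>
        (x, y) \<in> Restr R (fibre A q c) \<longleftrightarrow> (f x, f y) \<in> Restr S (fibre A q c)"
      using finite_strict_linear_order_iso[OF finite_fibre finite_fibre refl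
          fibrewise_linear_onD(3)[OF R] fibrewise_linear_onD(3)[OF S]] by blast
    then show "?fibre_iso c"
      using bij_betwE[OF f] by blast
  qed
  from choice[OF this] obtain F where F: "\<And>c. bij_betw (F c) (fibre A q c) (fibre A q c)"
    and F_iso: "\<And>c x y. x \<in> fibre A q c \<Longrightarrow> y \<in> fibre A q c \<Longrightarrow>
      (x, y) \<in> R \<longleftrightarrow> (F c x, F c y) \<in> S"
    by blast
  let ?f = "\<lambda>x. F (q x) x"
  have f: "?f x \<in> A" "q (?f x) = q x" if "x \<in> A" for x
    using bij_betwE[OF F] that by auto
  have "(x, y) \<in> R \<longleftrightarrow> (?f x, ?f y) \<in> S" if "x \<in> A" "y \<in> A" for x y
  proof (cases "q x = q y")
    case True
    then show ?thesis
      using F_iso[of x "q x" y] that by simp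
  next
    case False
    then show ?thesis
      using fibrewise_linear_onD(2)[OF R] fibrewise_linear_onD(2)[OF S] f that by simp
  qed
  with bij_betw_fibrewise[OF F] show thesis
    by (rule that)
qed

section \<open>Orientations of comparability graphs\<close>

lemma subgraph_with_proj_iff:
  "subgraph (with_proj D) (with_proj E) \<longleftrightarrow>
     pair_wf_digraph D \<and> pair_wf_digraph E \<and> pverts D \<subseteq> pverts E \<and> parcs D \<subseteq> parcs E"
  by (auto simp: subgraph_def compatible_def wf_digraph_wp_iff)

lemma digraph_iso_with_projI:
  assumes "pair_wf_digraph D" and "pair_wf_digraph E"
    and f: "bij_betw f (pverts D) (pverts E)"
    and arcs: "\<And>x y. x \<in> pverts D \<Longrightarrow> y \<in> pverts D \<Longrightarrow> (x, y) \<in> parcs D \<longleftrightarrow> (f x, f y) \<in> parcs E"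
  shows "digraph_iso (with_proj D) (with_proj E)"
proof -
  interpret D: pair_wf_digraph D by fact
  interpret E: pair_wf_digraph E by fact
  let ?h = "\<lparr> iso_verts = f, iso_arcs = map_prod f f, iso_head = snd, iso_tail = fst \<rparr>"
  have "parcs D \<subseteq> pverts D \<times> pverts D"
    using D.wellformed' by auto
  then have "inj_on (map_prod f f) (parcs D)"
    using map_prod_inj_on f by (metis bij_betw_def inj_on_subset)
  then have "D.digraph_isomorphism ?h"
    using f D.wf_digraph_axioms by (simp add: D.digraph_isomorphism_def bij_betw_def)
  moreover have "map_prod f f ` parcs D = parcs E"
  proof (intro equalityI subrelI)
    fix u v assume "(u, v) \<in> map_prod f f ` parcs D"
    then show "(u, v) \<in> parcs E"
      using arcs by (auto dest: D.wellformed')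
  next
    fix u v assume uv: "(u, v) \<in> parcs E"
    then obtain x y where "u = f x" "v = f y" "x \<in> pverts D" "y \<in> pverts D"
      using E.wellformed'[OF uv] bij_betw_imp_surj_on[OF f] by blast
    then show "(u, v) \<in> map_prod f f ` parcs D"
      using arcs uv by auto
  qed
  then have "with_proj E = app_iso ?h (with_proj D)"
    using f by (simp add: app_iso_def with_proj_def bij_betw_def)
  ultimately show ?thesis
    unfolding digraph_iso_def by blast
qed

definition comparability_graph :: "'a set \<Rightarrow> ('a \<Rightarrow> 'c::order) \<Rightarrow> 'a pair_pre_digraph" where
  "comparability_graph A q =
     \<lparr> pverts = A, parcs = {(x, y). x \<in> A \<and> y \<in> A \<and> x \<noteq> y \<and> (q x \<le> q y \<or> q y \<le> q x)} \<rparr>"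

definition descent_digraph :: "'a set \<Rightarrow> ('a \<Rightarrow> 'c::order) \<Rightarrow> 'a pair_pre_digraph" where
  "descent_digraph A q =
     \<lparr> pverts = A, parcs = {(x, y). x \<in> A \<and> y \<in> A \<and> x \<noteq> y \<and> q y \<le> q x} \<rparr>"

lemma fibrewise_linear_on_if_descending_transitive_orientation:
  assumes orientation: "transitive_orientation (comparability_graph A q) D"
    and sub: "parcs D \<subseteq> parcs (descent_digraph A q)"
  shows "fibrewise_linear_on A q (parcs D)"
  unfolding fibrewise_linear_on_def
proof (intro conjI ballI allI impI)
  have arc: "x \<in> A \<and> y \<in> A \<and> x \<noteq> y \<and> q y \<le> q x" if "(x, y) \<in> parcs D" for x y
    using subsetD[OF sub that] by (simp add: descent_digraph_def)
  have comparable: "(x, y) \<in> parcs D \<or> (y, x) \<in> parcs D"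
    if "x \<in> A" "y \<in> A" "x \<noteq> y" "q x \<le> q y \<or> q y \<le> q x" for x y
    using orientation that
    by (auto simp: transitive_orientation_def orientation_def comparability_graph_def)
  show "parcs D \<subseteq> A \<times> A"
    using arc by auto
  show "(x, y) \<in> parcs D \<longleftrightarrow> q y < q x" if "x \<in> A" "y \<in> A" "q x \<noteq> q y" for x y
    using that arc[of x y] arc[of y x] comparable[of x y] by fastforce
  have "trans (parcs D)"
    using orientation by (simp add: transitive_orientation_def)
  then show "strict_linear_order_on (fibre A q c) (Restr (parcs D) (fibre A q c))" for c
    using arc comparable by (auto simp: strict_linear_order_on_def irrefl_def total_on_def trans_Restr)
qed

lemma transitive_orientation_comparability_graphI:
  assumes "pverts D = A" and R: "fibrewise_linear_on A q (parcs D)"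
  shows "transitive_orientation (comparability_graph A q) D"
proof -
  have irrefl: "irrefl (parcs D)" and trans: "trans (parcs D)"
    using R by (rule fibrewise_linear_on_irrefl, rule fibrewise_linear_on_trans)
  have "parcs D \<subseteq> parcs (comparability_graph A q)"
    using fibrewise_linear_onD(1)[OF R] fibrewise_linear_on_imp_le[OF R] irrefl
    by (auto simp: comparability_graph_def irrefl_def)
  moreover have "((x, y) \<in> parcs D) \<noteq> ((y, x) \<in> parcs D)"
    if "(x, y) \<in> parcs (comparability_graph A q)" for x y
  proof -
    have "(x, y) \<in> parcs D \<or> (y, x) \<in> parcs D"
      using that fibrewise_linear_on_comparable[OF R, of x y]
      by (simp add: comparability_graph_def)
    moreover have "(x, y) \<notin> parcs D \<or> (y, x) \<notin> parcs D"
      using irrefl trans by (auto simp: irrefl_def dest: transD)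
    ultimately show ?thesis
      by blast
  qed
  ultimately show ?thesis
    using assms(1) trans
    by (auto simp: transitive_orientation_def orientation_def comparability_graph_def)
qed

lemma subgraph_descent_digraphI:
  assumes "pverts D = A" and R: "fibrewise_linear_on A q (parcs D)"
  shows "subgraph (with_proj D) (with_proj (descent_digraph A q))"
  using assms(1) fibrewise_linear_onD(1)[OF R] fibrewise_linear_on_imp_le[OF R]
    fibrewise_linear_on_irrefl[OF R]
  by (auto simp: subgraph_with_proj_iff descent_digraph_def irrefl_def pair_wf_digraph_def)

theorem descending_transitive_orientation_iff:
  "transitive_orientation (comparability_graph A q) D \<and>
     subgraph (with_proj D) (with_proj (descent_digraph A q)) \<longleftrightarrow>
   pverts D = A \<and> fibrewise_linear_on A q (parcs D)"
proof -
  have "pverts D = A" if "transitive_orientation (comparability_graph A q) D"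
    using that by (simp add: transitive_orientation_def orientation_def comparability_graph_def)
  then show ?thesis
    using fibrewise_linear_on_if_descending_transitive_orientation
      transitive_orientation_comparability_graphI subgraph_descent_digraphI
    by (metis subgraph_with_proj_iff)
qed

theorem descending_transitive_orientations_iso:
  assumes "\<And>c. finite (fibre A q c)"
    and "transitive_orientation (comparability_graph A q) D"
    and D: "subgraph (with_proj D) (with_proj (descent_digraph A q))"
    and "transitive_orientation (comparability_graph A q) E"
    and E: "subgraph (with_proj E) (with_proj (descent_digraph A q))"
  shows "digraph_iso (with_proj D) (with_proj E)"
proof -
  have verts: "pverts D = A" "pverts E = A"
    and linear: "fibrewise_linear_on A q (parcs D)" "fibrewise_linear_on A q (parcs E)"
    using assms(2-5) descending_transitive_orientation_iff[of A q D]
      descending_transitive_orientation_iff[of A q E] by simp_all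
  obtain f where "bij_betw f A A"
    and "\<And>x y. x \<in> A \<Longrightarrow> y \<in> A \<Longrightarrow> (x, y) \<in> parcs D \<longleftrightarrow> (f x, f y) \<in> parcs E"
    using fibrewise_linear_on_iso[OF assms(1) linear] by blast
  moreover have "pair_wf_digraph D" "pair_wf_digraph E"
    using D E by (simp_all add: subgraph_with_proj_iff)
  ultimately show ?thesis
    using verts by (intro digraph_iso_with_projI[of D E f]) auto
qed

section \<open>Power graphs\<close>

context group
begin

abbreviation cyclic_subgroup :: "'a \<Rightarrow> 'a set" where
  "cyclic_subgroup x \<equiv> generate G {x}"

lemma mem_cyclic_subgroup_iff:
  assumes "x \<in> carrier G" "y \<in> carrier G"
  shows "y \<in> cyclic_subgroup x \<longleftrightarrow> cyclic_subgroup y \<subseteq> cyclic_subgroup x"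
  using assms generate_subgroup_incl[of "{y}"] generate_is_subgroup[of "{x}"]
    generate.incl[of y "{y}" G] by auto

lemma is_pos_power_iff_cyclic_subgroup_subset:
  assumes "x \<in> carrier G" "y \<in> carrier G" and "0 < ord x"
  shows "is_pos_power G y x \<longleftrightarrow> cyclic_subgroup y \<subseteq> cyclic_subgroup x"
proof -
  have "is_pos_power G y x \<longleftrightarrow> (\<exists>k::nat. y = x [^] k)"
  proof
    assume "\<exists>k::nat. y = x [^] k"
    then obtain k :: nat where "y = x [^] (k + ord x)"
      using assms(1) by (auto simp flip: nat_pow_mult)
    then show "is_pos_power G y x"
      using assms(3) unfolding is_pos_power_def by (intro exI[of _ "k + ord x"]) simp
  qed (auto simp: is_pos_power_def)
  also have "\<dots> \<longleftrightarrow> y \<in> cyclic_subgroup x"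
    using assms by (auto simp: generate_pow_nat)
  also have "\<dots> \<longleftrightarrow> cyclic_subgroup y \<subseteq> cyclic_subgroup x"
    using assms(1,2) by (rule mem_cyclic_subgroup_iff)
  finally show ?thesis .
qed

lemma power_graph_eq_comparability_graph:
  assumes "\<And>x. x \<in> carrier G \<Longrightarrow> 0 < ord x"
  shows "power_graph G = comparability_graph (carrier G) cyclic_subgroup"
  by (auto simp: power_graph_def comparability_graph_def
      is_pos_power_iff_cyclic_subgroup_subset assms)

lemma power_digraph_eq_descent_digraph:
  assumes "\<And>x. x \<in> carrier G \<Longrightarrow> 0 < ord x"
  shows "power_digraph G = descent_digraph (carrier G) cyclic_subgroup"
  by (auto simp: power_digraph_def descent_digraph_def
      is_pos_power_iff_cyclic_subgroup_subset assms)

lemma gen_class_eq_fibre: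
  assumes "x \<in> carrier G"
  shows "gen_class G x = fibre (carrier G) cyclic_subgroup (cyclic_subgroup x)"
  using assms generate.incl[of _ "{_}" G] generate_in_carrier[of "{x}"]
  by (auto simp: gen_class_def)

lemma order_digraph_arc_iff:
  assumes "x \<in> carrier G" "y \<in> carrier G"
  shows "(x, y) \<in> parcs (order_digraph G L) \<longleftrightarrow>
    cyclic_subgroup x = cyclic_subgroup y \<and> (y, x) \<in> L (gen_class G x) - Id \<or>
    cyclic_subgroup y \<subset> cyclic_subgroup x"
proof -
  have "gen_class G y = gen_class G x \<longleftrightarrow> cyclic_subgroup y = cyclic_subgroup x"
    using assms by (auto simp: gen_class_eq_fibre)
  then show ?thesis
    using assms by (simp add: order_digraph_def prec_def) metis
qed

lemma fibrewise_linear_on_order_digraph: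
  assumes L: "\<And>C. C \<in> gen_class G ` carrier G \<Longrightarrow> linear_order_on C (L C)"
  shows "fibrewise_linear_on (carrier G) cyclic_subgroup (parcs (order_digraph G L))"
  unfolding fibrewise_linear_on_def
proof (intro conjI ballI allI impI)
  show "parcs (order_digraph G L) \<subseteq> carrier G \<times> carrier G"
    by (auto simp: order_digraph_def)
  show "(x, y) \<in> parcs (order_digraph G L) \<longleftrightarrow> cyclic_subgroup y \<subset> cyclic_subgroup x"
    if "x \<in> carrier G" "y \<in> carrier G" "cyclic_subgroup x \<noteq> cyclic_subgroup y" for x y
    using that by (simp add: order_digraph_arc_iff)
  fix c
  let ?C = "fibre (carrier G) cyclic_subgroup c"
  show "strict_linear_order_on ?C (Restr (parcs (order_digraph G L)) ?C)"
  proof (cases "?C = {}")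
    case True
    then show ?thesis
      by (simp only:) (simp add: strict_linear_order_on_def)
  next
    case False
    then have "?C \<in> gen_class G ` carrier G"
      by (auto simp: gen_class_eq_fibre)
    then have C: "linear_order_on ?C (L ?C)"
      by (rule L)
    have "Restr (parcs (order_digraph G L)) ?C = (L ?C)\<inverse> - Id"
      using partial_order_onD(4)[of ?C "L ?C"] C
      by (auto simp: linear_order_on_def order_digraph_arc_iff gen_class_eq_fibre)
    then show ?thesis
      using C by (simp add: strict_linear_order_on_diff_Id)
  qed
qed

end

theorem theorem2p3:
  fixes G :: "('a, 'b) monoid_scheme" and L :: "'a set \<Rightarrow> 'a rel"
  assumes "group G" and "finite (carrier G)"
    and "\<And>C. C \<in> gen_class G ` carrier G \<Longrightarrow> linear_order_on C (L C)"
  shows "transitive_orientation (power_graph G) (order_digraph G L) \<and>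
         subgraph (with_proj (order_digraph G L)) (with_proj (power_digraph G)) \<and>
         (\<forall>D. transitive_orientation (power_graph G) D \<and>
              subgraph (with_proj D) (with_proj (power_digraph G)) \<longrightarrow>
              digraph_iso (with_proj D) (with_proj (order_digraph G L)))"
proof -
  interpret group G
    by fact
  have "0 < ord x" if "x \<in> carrier G" for x
    using ord_ge_1[OF \<open>finite (carrier G)\<close> that] by simp
  then have power_graphs: "power_graph G = comparability_graph (carrier G) cyclic_subgroup"
    "power_digraph G = descent_digraph (carrier G) cyclic_subgroup"
    by (simp_all add: power_graph_eq_comparability_graph power_digraph_eq_descent_digraph)
  have "pverts (order_digraph G L) = carrier G"
    by (simp add: order_digraph_def)
  moreover have "fibrewise_linear_on (carrier G) cyclic_subgroup (parcs (order_digraph G L))"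
    using assms(3) by (rule fibrewise_linear_on_order_digraph)
  ultimately have order_digraph: "transitive_orientation (power_graph G) (order_digraph G L)"
    "subgraph (with_proj (order_digraph G L)) (with_proj (power_digraph G))"
    unfolding power_graphs
    by (rule transitive_orientation_comparability_graphI subgraph_descent_digraphI)+
  have "finite (fibre (carrier G) cyclic_subgroup c)" for c
    using \<open>finite (carrier G)\<close> by simp
  then have "digraph_iso (with_proj D) (with_proj (order_digraph G L))"
    if "transitive_orientation (power_graph G) D"
      "subgraph (with_proj D) (with_proj (power_digraph G))" for D
    using that order_digraph unfolding power_graphs by (rule descending_transitive_orientations_iso)
  with order_digraph show ?thesis
    by blast
qed

end
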